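(* Suppose $\delta<\alpha=\beta$. Then for $f(x)=\frac{x^3+ax^2+bx}{ax+b}$ the following hold. 1. $SI(0)=U_\alpha(0)$. 2. If $x\in S_\alpha(0)\setminus\mathcal{P}$ and $\alpha^*(x)=|f(x)|_p$, then: (a) if $\alpha^*(x)=\alpha$, then $f(x)\in S_\alpha(0)$; (b) if $\alpha^*(x)<\alpha$, then $f^n(x)\in S_{\alpha^*(x)}(0)$ for all $n\geq 1$. 3. If $r>\alpha$ and $x\in S_r(0)\setminus\mathcal{P}$, then $\lim_{n\to\infty}|f^n(x)|_p=+\infty$.
   Context: $p$ is a prime, $\mathbb{C}_p$ is the field of complex $p$-adic numbers with norm $|\cdot|_p$, and $a,b\in\mathbb{C}_p$ satisfy $ab\neq 0$. The function $f(x)=\frac{x^3+ax^2+bx}{ax+b}$ is defined for $x\in\mathbb{C}_p$, $x\neq\hat x:=-\frac{b}{a}$; its unique fixed point is $x_0=0$. Let $x_1,x_2=\frac{-a\pm\sqrt{a^2-4b}}{2}$ be the roots of $x^2+ax+b$ in $\mathbb{C}_p$ and put $\delta=|a|_p$, $\alpha=|x_1|_p$, $\beta=|x_2|_p$. $U_r(c)=\{x\in\mathbb{C}_p:|x-c|_p<r\}$, $S_r(c)=\{x\in\mathbb{C}_p:|x-c|_p=r\}$ (with $S_0(0)=\{0\}$). $\mathcal{P}=\{x\in\mathbb{C}_p:\exists n\in\mathbb{N}\cup\{0\},\ f^n(x)=\hat x\}$, where $f^n$ is the $n$-fold iterate. A sphere $S_\rho(0)$ is invariant for $f$ if $x\in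 S_\rho(0)$ implies that $f^n(x)$ is defined and lies in $S_\rho(0)$ for all $n\geq1$. The ball $U_r(0)$ is a Siegel disk if every sphere $S_\rho(0)$ with $\rho<r$ is invariant for $f$; $SI(0)$, the maximum Siegel disk, is the union of all Siegel disks centered at $0$. *)

theory Defs
  imports "HOL-Analysis.Analysis" "HOL-Computational_Algebra.Computational_Algebra"
begin

definition padic_abs_rat :: "nat \<Rightarrow> rat \<Rightarrow> real" where
  "padic_abs_rat p q =
     (if q = 0 then 0
      else case quotient_of q of (m, n) \<Rightarrow>
        real p powi (int (multiplicity (int p) n) - int (multiplicity (int p) m)))"

locale ultrametric_field =
  fixes absv :: "'a::field_char_0 \<Rightarrow> real"
  assumes absv_nonneg: "absv x \<ge> 0"
    and absv_eq_0_iff: "absv x = 0 \<longleftrightarrow> x = 0"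
    and absv_mult: "absv (x * y) = absv x * absv y"
    and absv_ultrametric: "absv (x + y) \<le> max (absv x) (absv y)"
begin

lemma absv_minus: "absv (- x) = absv x"
proof -
  have "absv 1 * absv 1 = absv 1"
    using absv_mult[of 1 1] by simp
  then have one: "absv 1 = 1"
    using absv_eq_0_iff[of 1] by simp
  have "absv (-1) * absv (-1) = 1"
    using absv_mult[of "-1" "-1"] one by simp
  then have "absv (-1) = 1"
    using absv_nonneg[of "-1"] by (simp add: square_eq_1_iff)
  then show ?thesis
    using absv_mult[of "-1" x] by simp
qed

sublocale Metric_space UNIV "\<lambda>x y. absv (x - y)"
proof
  fix x y z :: 'a
  show "0 \<le> absv (x - y)" by (rule absv_nonneg)
  show "absv (x - y) = absv (y - x)"
    using absv_minus[of "x - y"] by simp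
  show "(absv (x - y) = 0) = (x = y)"
    by (simp add: absv_eq_0_iff)
  show "absv (x - z) \<le> absv (x - y) + absv (y - z)"
    using absv_ultrametric[of "x - y" "y - z"]
      absv_nonneg[of "x - y"] absv_nonneg[of "y - z"] by simp
qed

definition closed_prime_field :: "'a set" where
  "closed_prime_field = mtopology closure_of \<rat>"

definition algebraic_over_closed_prime_field :: "'a set" where
  "algebraic_over_closed_prime_field =
     {x. \<exists>P. P \<noteq> 0 \<and> (\<forall>i. coeff P i \<in> closed_prime_field) \<and> poly P x = 0}"

end

(* The field of complex p-adic numbers is the completion of an algebraic closure
   of \<rat>\<^sub>p, which determines it up to isometric isomorphism; the locale
   says that 'a with absv is such a field. In a complete field whose absolute value
   extends the p-adic one, the closure of \<rat> is the completion \<rat>\<^sub>p of \<rat>;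
   as 'a is algebraically closed, the elements algebraic over \<rat>\<^sub>p form an
   algebraic closure of it; completeness and density make 'a its completion. *)
locale complex_padic_field = ultrametric_field absv
  for absv :: "'a::{field_char_0, alg_closed_field} \<Rightarrow> real" +
  fixes p :: nat
  assumes prime_p: "prime p"
    and absv_of_rat: "absv (of_rat q) = padic_abs_rat p q"
    and complete: mcomplete
    and algebraic_dense: "mtopology closure_of algebraic_over_closed_prime_field = UNIV"

definition ultra_ball :: "('a::field \<Rightarrow> real) \<Rightarrow> 'a \<Rightarrow> real \<Rightarrow> 'a set" where
  "ultra_ball absv c r = {x. absv (x - c) < r}"

definition ultra_sphere :: "('a::field \<Rightarrow> real) \<Rightarrow> 'a \<Rightarrow> real \<Rightarrow> 'a set" where
  "ultra_sphere absv c r = {x. absv (x - c) = r}"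

definition f_pole :: "'a::field \<Rightarrow> 'a \<Rightarrow> 'a" where
  "f_pole a b = - (b / a)"

(* At the pole this total function takes the junk value 0. *)
definition f_map :: "'a::field \<Rightarrow> 'a \<Rightarrow> 'a \<Rightarrow> 'a" where
  "f_map a b x = (x ^ 3 + a * x ^ 2 + b * x) / (a * x + b)"

definition iterate_defined :: "'a::field \<Rightarrow> 'a \<Rightarrow> nat \<Rightarrow> 'a \<Rightarrow> bool" where
  "iterate_defined a b n x \<longleftrightarrow> (\<forall>k<n. (f_map a b ^^ k) x \<noteq> f_pole a b)"

(* The least n below is reached through defined iterates only, so the junk value
   of f_map at the pole does not enlarge this set. *)
definition pole_preimages :: "'a::field \<Rightarrow> 'a \<Rightarrow> 'a set" where
  "pole_preimages a b = {x. \<exists>n. (f_map a b ^^ n) x = f_pole a b}"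

definition invariant_sphere :: "('a::field \<Rightarrow> real) \<Rightarrow> 'a \<Rightarrow> 'a \<Rightarrow> real \<Rightarrow> bool" where
  "invariant_sphere absv a b \<rho> \<longleftrightarrow>
     (\<forall>x\<in>ultra_sphere absv 0 \<rho>. \<forall>n\<ge>1.
        iterate_defined a b n x \<and> (f_map a b ^^ n) x \<in> ultra_sphere absv 0 \<rho>)"

definition siegel_disk :: "('a::field \<Rightarrow> real) \<Rightarrow> 'a \<Rightarrow> 'a \<Rightarrow> 'a set \<Rightarrow> bool" where
  "siegel_disk absv a b D \<longleftrightarrow>
     (\<exists>r>0. D = ultra_ball absv 0 r \<and> (\<forall>\<rho>. 0 \<le> \<rho> \<and> \<rho> < r \<longrightarrow> invariant_sphere absv a b \<rho>))"

definition max_siegel_disk :: "('a::field \<Rightarrow> real) \<Rightarrow> 'a \<Rightarrow> 'a \<Rightarrow> 'a set" where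
  "max_siegel_disk absv a b = \<Union> {D. siegel_disk absv a b D}"

end

theory Submission
  imports Defs
begin

text \<open>The roots give \<open>|b| = \<alpha>\<^sup>2\<close>. By the isosceles property, on \<open>|x| < \<alpha>\<close> both
  \<open>x\<^sup>2 + a x + b\<close> and \<open>a x + b\<close> have absolute value \<open>\<alpha>\<^sup>2\<close>, so \<open>f\<close> preserves the
  absolute value; on \<open>|x| > \<alpha>\<close> the numerator has absolute value \<open>|x|\<^sup>3\<close> and the denominator at most
  \<open>\<alpha> |x|\<close>, so \<open>|f(x)| \<ge> |x|\<^sup>2 / \<alpha>\<close> and orbits escape geometrically. The Siegel disk
  cannot extend beyond \<open>\<alpha>\<close> because \<open>f\<close> maps the root \<open>x\<^sub>1\<close>, which lies on
  \<open>S\<^sub>\<alpha>(0)\<close>, to \<open>0\<close>.\<close>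

context ultrametric_field
begin

lemma absv_zero [simp]: "absv 0 = 0"
  by (simp add: absv_eq_0_iff)

lemma absv_divide: "absv (x / y) = absv x / absv y"
proof (cases "y = 0")
  case False
  then have "absv (x / y) * absv y = absv x"
    by (simp flip: absv_mult)
  with False show ?thesis
    by (simp add: absv_eq_0_iff field_simps)
qed simp

lemma absv_power2: "absv (x ^ 2) = absv x ^ 2"
  by (simp add: power2_eq_square absv_mult)

text \<open>The isosceles property: the reverse bound comes from writing \<open>x\<close> as
  \<open>(x + y) + (- y)\<close>, where the maximum cannot be attained by \<open>y\<close>.\<close>

lemma absv_add_eq_left:
  assumes "absv y < absv x"
  shows "absv (x + y) = absv x"
  using absv_ultrametric[of x y] absv_ultrametric[of "x + y" "- y"] assms
  by (simp add: absv_minus max_def split: if_splits)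

end

lemma f_map_factor: "f_map a b x = x * (x ^ 2 + a * x + b) / (a * x + b)"
  unfolding f_map_def by (simp add: algebra_simps power2_eq_square power3_eq_cube)

text \<open>The hypotheses on the two roots are condensed into the coefficients: their product is
  \<open>b\<close>, so equal absolute values \<alpha> give \<open>absv_b\<close>.\<close>

locale dominant_roots = ultrametric_field absv
  for absv :: "'a::field_char_0 \<Rightarrow> real" +
  fixes a b :: 'a and \<alpha> :: real
  assumes a_nonzero: "a \<noteq> 0"
    and absv_a: "absv a < \<alpha>"
    and absv_b: "absv b = \<alpha> ^ 2"
begin

lemma alpha_pos: "\<alpha> > 0"
  using absv_a absv_nonneg[of a] by linarith

text \<open>The constant term dominates because \<open>absv a\<close> is strictly below \<alpha>.
  The bounding sphere is included, so the pole lies strictly outside the closed ball.\<close>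

lemma absv_denominator:
  assumes "absv x \<le> \<alpha>"
  shows "absv (a * x + b) = \<alpha> ^ 2"
proof -
  have "absv a * absv x \<le> absv a * \<alpha>"
    using assms absv_nonneg by (intro mult_left_mono)
  also have "\<dots> < \<alpha> * \<alpha>"
    using absv_a alpha_pos by simp
  finally have "absv (a * x) < absv b"
    by (simp add: absv_mult absv_b power2_eq_square)
  then show ?thesis
    using absv_add_eq_left[of "a * x" b] by (simp add: absv_b add.commute)
qed

lemma denominator_eq_0_iff: "a * x + b = 0 \<longleftrightarrow> x = f_pole a b"
  using a_nonzero by (auto simp: f_pole_def field_simps eq_neg_iff_add_eq_0)

lemma not_pole: "absv x \<le> \<alpha> \<Longrightarrow> x \<noteq> f_pole a b"
  using absv_denominator[of x] denominator_eq_0_iff[of x] alpha_pos by auto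

lemma absv_f_map_inside:
  assumes "absv x < \<alpha>"
  shows "absv (f_map a b x) = absv x"
proof -
  \<comment> \<open>The quadratic factor is the denominator perturbed by a strictly smaller term, so
    the two cancel in absolute value.\<close>
  have "absv (x ^ 2) < absv (a * x + b)"
    using assms absv_nonneg[of x]
    by (simp add: absv_denominator absv_power2 power_strict_mono)
  then have "absv ((a * x + b) + x ^ 2) = \<alpha> ^ 2"
    using assms by (simp add: absv_add_eq_left absv_denominator)
  then have "absv (x ^ 2 + a * x + b) = \<alpha> ^ 2"
    by (simp add: ac_simps)
  with assms alpha_pos show ?thesis
    by (simp add: f_map_factor absv_divide absv_mult absv_denominator)
qed

lemma absv_funpow_f_map_inside:
  assumes "absv x < \<alpha>"
  shows "absv ((f_map a b ^^ n) x) = absv x"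
  using assms by (induction n) (simp_all add: absv_f_map_inside)

text \<open>For negative \<rho> the sphere is empty, so no sign condition appears.\<close>

lemma invariant_sphere_inside:
  assumes "\<rho> < \<alpha>"
  shows "invariant_sphere absv a b \<rho>"
  using assms not_pole absv_funpow_f_map_inside
  by (auto simp: invariant_sphere_def ultra_sphere_def iterate_defined_def)

lemma absv_f_map_outside:
  assumes x: "absv x > \<alpha>" "x \<noteq> f_pole a b"
  shows "absv (f_map a b x) \<ge> absv x ^ 2 / \<alpha>"
proof -
  have xpos: "absv x > 0"
    using x(1) alpha_pos by linarith
  have "absv a * absv x \<le> \<alpha> * absv x"
    using absv_a xpos by simp
  moreover have "\<alpha> ^ 2 \<le> \<alpha> * absv x"
    using x(1) alpha_pos by (simp add: power2_eq_square)
  ultimately have den: "absv (a * x + b) \<le> \<alpha> * absv x"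
    using absv_ultrametric[of "a * x" b] by (simp add: absv_mult absv_b)
  also have "\<dots> < absv (x ^ 2)"
    using x(1) xpos by (simp add: power2_eq_square absv_mult)
  finally have "absv (x ^ 2 + (a * x + b)) = absv x ^ 2"
    by (simp add: absv_add_eq_left absv_power2)
  then have num: "absv (x ^ 2 + a * x + b) = absv x ^ 2"
    by (simp add: ac_simps)
  \<comment> \<open>At the pole the junk value 0 would violate the bound.\<close>
  have "absv (a * x + b) \<noteq> 0"
    using x(2) by (simp add: denominator_eq_0_iff absv_eq_0_iff)
  then have den_pos: "absv (a * x + b) > 0"
    using absv_nonneg[of "a * x + b"] by linarith
  have "absv x ^ 2 / \<alpha> = absv x * absv x ^ 2 / (\<alpha> * absv x)"
    using xpos by simp
  also have "\<dots> \<le> absv x * absv x ^ 2 / absv (a * x + b)"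
    using den den_pos xpos by (intro divide_left_mono) (auto intro: mult_pos_pos)
  also have "\<dots> = absv (f_map a b x)"
    by (simp add: f_map_factor absv_divide absv_mult num)
  finally show ?thesis .
qed

lemma funpow_f_map_escapes:
  assumes x: "absv x > \<alpha>" "x \<notin> pole_preimages a b"
  shows "filterlim (\<lambda>n. absv ((f_map a b ^^ n) x)) at_top sequentially"
proof -
  define q where "q = absv x / \<alpha>"
  have q: "q > 1"
    using x(1) alpha_pos by (simp add: q_def)
  \<comment> \<open>The ratio of the absolute value to \<alpha> is at least squared at each step. It
    suffices to bound one factor of the square by \<open>q\<close> and the other by induction. The
    exponent \<open>Suc n\<close> makes the case 0 an equality.\<close>
  have lower: "absv ((f_map a b ^^ n) x) \<ge> \<alpha> * q ^ Suc n" for n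
  proof (induction n)
    case 0
    then show ?case
      using alpha_pos by (simp add: q_def)
  next
    case (Suc n)
    let ?y = "(f_map a b ^^ n) x"
    have "1 < q ^ Suc n"
      using q by (rule power_gt1)
    then have "\<alpha> < \<alpha> * q ^ Suc n"
      using alpha_pos by (simp del: power_Suc)
    with Suc.IH have y: "absv ?y > \<alpha>"
      by linarith
    have "q ^ 1 \<le> q ^ Suc n"
      using q by (intro power_increasing) auto
    then have "\<alpha> * q \<le> \<alpha> * q ^ Suc n"
      using alpha_pos by (intro mult_left_mono) auto
    with Suc.IH have "\<alpha> * q \<le> absv ?y"
      by linarith
    then have "(\<alpha> * q) * (\<alpha> * q ^ Suc n) \<le> absv ?y * absv ?y"
      using Suc.IH alpha_pos q absv_nonneg by (intro mult_mono) auto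
    then have "\<alpha> * q ^ Suc (Suc n) \<le> absv ?y ^ 2 / \<alpha>"
      using alpha_pos by (simp add: field_simps power2_eq_square)
    \<comment> \<open>Avoiding \<open>pole_preimages\<close> keeps every iterate off the
      pole.\<close>
    also have "\<dots> \<le> absv (f_map a b ?y)"
      using y x(2) by (intro absv_f_map_outside) (auto simp: pole_preimages_def)
    finally show ?case
      by simp
  qed
  have "filterlim (\<lambda>n. q ^ n) at_top sequentially"
    using q by (intro filterlim_at_infinity_imp_filterlim_at_top
        filterlim_realpow_sequentially_gt1) auto
  then have "filterlim (\<lambda>n. q ^ Suc n) at_top sequentially"
    by (rule filterlim_compose[OF _ filterlim_Suc])
  then have "filterlim (\<lambda>n. \<alpha> * q ^ Suc n) at_top sequentially"
    using alpha_pos by (intro filterlim_tendsto_pos_mult_at_top[OF tendsto_const])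
  then show ?thesis
    by (rule filterlim_at_top_mono) (use lower in \<open>auto intro: always_eventually\<close>)
qed

text \<open>The root \<open>c\<close> is the witness that the sphere of radius \<alpha> is not
  invariant.\<close>

lemma max_siegel_disk_eq:
  assumes root: "absv c = \<alpha>" "c ^ 2 + a * c + b = 0"
  shows "max_siegel_disk absv a b = ultra_ball absv 0 \<alpha>"
proof -
  have "siegel_disk absv a b (ultra_ball absv 0 \<alpha>)"
    using alpha_pos invariant_sphere_inside by (auto simp: siegel_disk_def)
  moreover have "D \<subseteq> ultra_ball absv 0 \<alpha>" if "siegel_disk absv a b D" for D
  proof -
    from that obtain r where r: "D = ultra_ball absv 0 r"
      "\<And>\<rho>. 0 \<le> \<rho> \<Longrightarrow> \<rho> < r \<Longrightarrow> invariant_sphere absv a b \<rho>"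
      by (auto simp: siegel_disk_def)
    have "\<not> invariant_sphere absv a b \<alpha>"
    proof
      assume "invariant_sphere absv a b \<alpha>"
      then have "(f_map a b ^^ 1) c \<in> ultra_sphere absv 0 \<alpha>"
        using root(1) unfolding invariant_sphere_def ultra_sphere_def
        by (metis (mono_tags, lifting) diff_zero mem_Collect_eq order_refl)
      then show False
        using root(2) alpha_pos by (simp add: ultra_sphere_def f_map_factor)
    qed
    then have "r \<le> \<alpha>"
      using r(2)[of \<alpha>] alpha_pos by fastforce
    then show ?thesis
      by (auto simp: r(1) ultra_ball_def)
  qed
  ultimately show ?thesis
    unfolding max_siegel_disk_def by blast
qed

end

theorem theorem2:
  fixes p :: nat
    and absv :: "'a::{field_char_0, alg_closed_field} \<Rightarrow> real"
    and a b s x1 x2 :: 'a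
    and \<delta> \<alpha> \<beta> :: real
  assumes "complex_padic_field absv p"
    and "a * b \<noteq> 0"
    and "s ^ 2 = a ^ 2 - 4 * b"
    and "x1 = (- a + s) / 2"
    and "x2 = (- a - s) / 2"
    and "\<delta> = absv a"
    and "\<alpha> = absv x1"
    and "\<beta> = absv x2"
    and "\<delta> < \<alpha>"
    and "\<alpha> = \<beta>"
  shows "max_siegel_disk absv a b = ultra_ball absv 0 \<alpha> \<and>
    (\<forall>x \<in> ultra_sphere absv 0 \<alpha> - pole_preimages a b.
       \<forall>\<alpha>'. \<alpha>' = absv (f_map a b x) \<longrightarrow>
         (\<alpha>' = \<alpha> \<longrightarrow> f_map a b x \<in> ultra_sphere absv 0 \<alpha>) \<and>
         (\<alpha>' < \<alpha> \<longrightarrow> (\<forall>n\<ge>1. (f_map a b ^^ n) x \<in> ultra_sphere absv 0 \<alpha>'))) \<and>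
    (\<forall>r>\<alpha>. \<forall>x \<in> ultra_sphere absv 0 r - pole_preimages a b.
       filterlim (\<lambda>n. absv ((f_map a b ^^ n) x)) at_top sequentially)"
proof -
  interpret complex_padic_field absv p
    by fact
  \<comment> \<open>Eliminating \<open>b\<close> turns the facts about the roots into identities in
    \<open>a\<close> and \<open>s\<close>.\<close>
  have b_eq: "b = (a ^ 2 - s ^ 2) / 4"
    using assms(3) by simp
  have root: "x1 ^ 2 + a * x1 + b = 0" and b: "b = x1 * x2"
    unfolding assms(4,5) b_eq by (simp_all add: field_simps power2_eq_square)
  interpret dominant_roots absv a b \<alpha>
  proof
    show "absv b = \<alpha> ^ 2"
      using assms(7,8,10) by (simp add: b absv_mult power2_eq_square)
  qed (use assms in auto)
  \<comment> \<open>The first step enters the open ball; the remaining \<open>n - 1\<close> steps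
    start from \<open>f_map a b x\<close> and preserve its absolute value.\<close>
  have "(f_map a b ^^ n) x \<in> ultra_sphere absv 0 (absv (f_map a b x))"
    if x: "absv (f_map a b x) < \<alpha>" and n: "n \<ge> 1" for x n
  proof -
    obtain m where "n = Suc m"
      using n by (cases n) auto
    then show ?thesis
      using absv_funpow_f_map_inside[OF x, of m]
      by (simp add: ultra_sphere_def funpow_swap1)
  qed
  then show ?thesis
    using max_siegel_disk_eq[OF assms(7)[symmetric] root] funpow_f_map_escapes
    by (auto simp: ultra_sphere_def)
qed

end
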